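(* No almost one-to-one pseudorandom generator with stretch factor $n+1$ over a certain alphabet exists in $\mathrm{CFLMV}$ against $\mathrm{CFL}$.
   Context: An alphabet is a finite nonempty set; CFL is the family of context-free languages. A function $\mu:\mathbb{N}\to\mathbb{R}^{\ge 0}$ is negligible if for every positive-valued polynomial $p$ with integer coefficients there is a positive number $n_0$ with $\mu(n)\le 1/p(n)$ for all integers $n\ge n_0$. A generator over an alphabet $\Sigma$ is a single-valued total function $G:\Sigma^*\to\Sigma^*$; it has stretch factor $s(n)$ if $|G(x)|=s(|x|)$ for every $x\in\Sigma^*$ (so stretch factor $n+1$ means $|G(x)|=|x|+1$). A generator $G$ with stretch factor $s(n)$ fools a language $A$ over $\Sigma$ if the function $\ell(n)=\left|\mathrm{Prob}_{x\in\Sigma^n}[G(x)\in A]-\mathrm{Prob}_{y\in\Sigma^{s(n)}}[y\in A]\right|$ is negligible, where $x$ and $y$ are uniformly distributed. $G$ is a pseudorandom generator against a language family $\mathcal{C}$ if it fools every language over $\Sigma$ in $\mathcal{C}$. $G$ is almost one-to-one (almost 1-1) if there is a negligible function $\varepsilon$ with $|\{G(x):x\in\Sigma^n\}|=|\Sigma^n|(1-\varepsilon(n))$ for all integers $n\ge 1$. An npda is a one-way one-head nondeterministic pushdown automaton whose input is surrounded by two endmarkers, whose head may stay stationary, and all of whose computation paths terminate in $O(n)$ steps on inputs of length $n$. $\mathrm{CFLMV}$ is the set of multi-valued partial functions $f$ from $\Sigma^*$ to $\Gamma^*$ (for alphabets $\Sigma,\Gamma$) for which there is an npda equipped with a write-only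 output tape (whose head only moves forward and never reads written symbols) such that, for every input $x\in\Sigma^*$, $f(x)$ is the set of all strings produced on the output tape along accepting computation paths on $x$ ($f(x)$ is regarded as undefined when this set is empty). A single-valued total function $G$ is identified with $x\mapsto\{G(x)\}$.
   Formalization: The alphabet is required to have at least two letters; over a one-letter alphabet G(a^n)=a^(n+1) is one-to-one, lies in CFLMV and fools every language, so the claim fails there. *)

theory Defs
  imports "HOL-Probability.Probability_Mass_Function" "HOL-Computational_Algebra.Polynomial"
begin

definition alphabet :: "'a set \<Rightarrow> bool" where
  "alphabet \<Sigma> \<longleftrightarrow> finite \<Sigma> \<and> \<Sigma> \<noteq> {}"

definition strings :: "'a set \<Rightarrow> nat \<Rightarrow> 'a list set" where
  "strings \<Sigma> n = {x. set x \<subseteq> \<Sigma> \<and> length x = n}"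


section \<open>Context-free languages\<close>

datatype ('n, 't) sym = Nt 'n | Tm 't

type_synonym ('n, 't) prods = "('n \<times> ('n, 't) sym list) set"

definition derives1 :: "('n, 't) prods \<Rightarrow> ('n, 't) sym list \<Rightarrow> ('n, 't) sym list \<Rightarrow> bool" where
  "derives1 P u v \<longleftrightarrow> (\<exists>l A r \<alpha>. (A, \<alpha>) \<in> P \<and> u = l @ [Nt A] @ r \<and> v = l @ \<alpha> @ r)"

definition gen_lang :: "('n, 't) prods \<Rightarrow> 'n \<Rightarrow> 't list set" where
  "gen_lang P S = {w. (derives1 P)\<^sup>*\<^sup>* [Nt S] (map Tm w)}"

text \<open>
  A grammar has finitely many productions, hence uses finitely many nonterminals, so taking
  natural numbers as nonterminals is no restriction.
\<close>
definition CFL :: "'a set \<Rightarrow> 'a list set set" where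
  "CFL \<Sigma> = {gen_lang P S | (P :: (nat, 'a) prods) S.
     finite P \<and> (\<forall>(A, \<alpha>) \<in> P. \<forall>a. Tm a \<in> set \<alpha> \<longrightarrow> a \<in> \<Sigma>)}"


section \<open>Pushdown automata with output\<close>

datatype 'a cell = LeftEnd | Inp 'a | RightEnd

text \<open>
  A transition \<open>((q, c, Z), (q', \<gamma>, mv, b))\<close> applies in state \<open>q\<close> with \<open>c\<close> under the input
  head and \<open>Z\<close> on top of the stack.  It enters \<open>q'\<close>, replaces \<open>Z\<close> by \<open>\<gamma>\<close> (whose first symbol
  becomes the new top), moves the head one cell to the right iff \<open>mv\<close> holds, and appends
  the symbol \<open>b\<close>, if any, to the output tape.
\<close>
record ('q, 's, 'a, 'b) npda =
  states :: "'q set"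
  stack_syms :: "'s set"
  trans :: "(('q \<times> 'a cell \<times> 's) \<times> ('q \<times> 's list \<times> bool \<times> 'b option)) set"
  init :: 'q
  bottom :: 's
  acc :: "'q set"

text \<open>
  Accepting states are halting.  Any other configuration without a successor (stuck, or empty
  stack) is a rejecting halt, so no separate rejecting states are needed.
\<close>
definition wf_npda :: "'a set \<Rightarrow> 'b set \<Rightarrow> ('q, 's, 'a, 'b) npda \<Rightarrow> bool" where
  "wf_npda \<Sigma> \<Gamma> M \<longleftrightarrow>
     finite (states M) \<and> finite (stack_syms M) \<and> finite (trans M) \<and>
     init M \<in> states M \<and> bottom M \<in> stack_syms M \<and> acc M \<subseteq> states M \<and>
     (\<forall>((q, c, Z), (q', \<gamma>, mv, b)) \<in> trans M.
        q \<in> states M - acc M \<and> set_cell c \<subseteq> \<Sigma> \<and> Z \<in> stack_syms M \<and>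
        q' \<in> states M \<and> set \<gamma> \<subseteq> stack_syms M \<and> set_option b \<subseteq> \<Gamma> \<and>
        (c = RightEnd \<longrightarrow> \<not> mv))"

text \<open>
  A configuration consists of the state, the input tape from the head position onwards (the
  head being one-way, cells to its left are irrelevant), the stack, and the output so far.
\<close>
type_synonym ('q, 's, 'a, 'b) config = "'q \<times> 'a cell list \<times> 's list \<times> 'b list"

definition init_config :: "('q, 's, 'a, 'b) npda \<Rightarrow> 'a list \<Rightarrow> ('q, 's, 'a, 'b) config" where
  "init_config M x = (init M, LeftEnd # map Inp x @ [RightEnd], [bottom M], [])"

inductive step :: "('q, 's, 'a, 'b) npda \<Rightarrow> ('q, 's, 'a, 'b) config \<Rightarrow>
    ('q, 's, 'a, 'b) config \<Rightarrow> bool" for M where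
  "((q, c, Z), (q', \<gamma>, mv, b)) \<in> trans M \<Longrightarrow>
   step M (q, c # t, Z # s, w)
     (q', if mv then t else c # t, \<gamma> @ s, w @ (case b of None \<Rightarrow> [] | Some y \<Rightarrow> [y]))"

text \<open>All computation paths, accepting or not, have length \<open>O(n)\<close>.\<close>
definition linear_time :: "'a set \<Rightarrow> ('q, 's, 'a, 'b) npda \<Rightarrow> bool" where
  "linear_time \<Sigma> M \<longleftrightarrow>
     (\<exists>d::nat. \<forall>x k C. set x \<subseteq> \<Sigma> \<longrightarrow> (step M ^^ k) (init_config M x) C \<longrightarrow> k \<le> d * (length x + 1))"

definition outputs :: "('q, 's, 'a, 'b) npda \<Rightarrow> 'a list \<Rightarrow> 'b list set" where
  "outputs M x = {w. \<exists>q t s. (step M)\<^sup>*\<^sup>* (init_config M x) (q, t, s, w) \<and> q \<in> acc M}"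

text \<open>
  A multi-valued partial function from \<open>\<Sigma>\<^sup>*\<close> to \<open>\<Gamma>\<^sup>*\<close> is a set-valued function of which only the
  values on \<open>\<Sigma>\<^sup>*\<close> matter; the empty set stands for undefined.  State sets and stack alphabets
  are finite, so natural numbers suffice for them.
\<close>
definition CFLMV :: "'a set \<Rightarrow> 'b set \<Rightarrow> ('a list \<Rightarrow> 'b list set) set" where
  "CFLMV \<Sigma> \<Gamma> = {f. \<exists>M :: (nat, nat, 'a, 'b) npda.
     wf_npda \<Sigma> \<Gamma> M \<and> linear_time \<Sigma> M \<and> (\<forall>x. set x \<subseteq> \<Sigma> \<longrightarrow> f x = outputs M x)}"


section \<open>Pseudorandom generators\<close>

definition negligible_fn :: "(nat \<Rightarrow> real) \<Rightarrow> bool" where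
  "negligible_fn \<mu> \<longleftrightarrow> (\<forall>n. 0 \<le> \<mu> n) \<and>
     (\<forall>p :: int poly. (\<forall>n::nat. 0 < poly p (int n)) \<longrightarrow>
        (\<exists>n0>0. \<forall>n\<ge>n0. \<mu> n \<le> 1 / real_of_int (poly p (int n))))"

definition generator :: "'a set \<Rightarrow> ('a list \<Rightarrow> 'a list) \<Rightarrow> bool" where
  "generator \<Sigma> G \<longleftrightarrow> (\<forall>x. set x \<subseteq> \<Sigma> \<longrightarrow> set (G x) \<subseteq> \<Sigma>)"

definition stretch_factor :: "'a set \<Rightarrow> ('a list \<Rightarrow> 'a list) \<Rightarrow> (nat \<Rightarrow> nat) \<Rightarrow> bool" where
  "stretch_factor \<Sigma> G s \<longleftrightarrow> (\<forall>x. set x \<subseteq> \<Sigma> \<longrightarrow> length (G x) = s (length x))"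

definition fools :: "'a set \<Rightarrow> (nat \<Rightarrow> nat) \<Rightarrow> ('a list \<Rightarrow> 'a list) \<Rightarrow> 'a list set \<Rightarrow> bool" where
  "fools \<Sigma> s G A \<longleftrightarrow> negligible_fn (\<lambda>n.
     \<bar>measure_pmf.prob (pmf_of_set (strings \<Sigma> n)) {x. G x \<in> A}
      - measure_pmf.prob (pmf_of_set (strings \<Sigma> (s n))) {y. y \<in> A}\<bar>)"

definition pseudorandom_generator ::
    "'a set \<Rightarrow> (nat \<Rightarrow> nat) \<Rightarrow> ('a list \<Rightarrow> 'a list) \<Rightarrow> 'a list set set \<Rightarrow> bool" where
  "pseudorandom_generator \<Sigma> s G \<C> \<longleftrightarrow>
     generator \<Sigma> G \<and> stretch_factor \<Sigma> G s \<and>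
     (\<forall>A \<in> \<C>. A \<subseteq> lists \<Sigma> \<longrightarrow> fools \<Sigma> s G A)"

text \<open>
  Over a one-letter alphabet \<open>a\<^sup>n \<mapsto> a\<^sup>n\<^sup>+\<^sup>1\<close> is one-to-one and fools every language, so
  nonexistence results must assume at least two letters.
\<close>
definition almost_one_to_one :: "'a set \<Rightarrow> ('a list \<Rightarrow> 'a list) \<Rightarrow> bool" where
  "almost_one_to_one \<Sigma> G \<longleftrightarrow> (\<exists>\<epsilon>. negligible_fn \<epsilon> \<and>
     (\<forall>n\<ge>1. real (card (G ` strings \<Sigma> n)) = real (card (strings \<Sigma> n)) * (1 - \<epsilon> n)))"

end

theory Submission imports Defs begin

text \<open>
  The range of a function in CFLMV is context-free: a pushdown automaton guesses the argument
  symbol by symbol and simulates the transducer, whose output takes the place of the input word.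
  The generator always lands in its range, whereas at length \<open>n + 1\<close> the range has at most
  \<open>|\<Sigma>|\<^sup>n\<close> of the \<open>|\<Sigma>|\<^sup>n\<^sup>+\<^sup>1\<close> strings; so the range is a context-free distinguisher with
  advantage at least \<open>1 - 1 / |\<Sigma>|\<close>.
\<close>

section \<open>Context-free grammars\<close>

lemma derives1_context: "derives1 P u v \<Longrightarrow> derives1 P (x @ u @ y) (x @ v @ y)"
  unfolding derives1_def by (metis append.assoc)

lemma derives_context:
  "(derives1 P)\<^sup>*\<^sup>* u v \<Longrightarrow> (derives1 P)\<^sup>*\<^sup>* (x @ u @ y) (x @ v @ y)"
  by (induction rule: rtranclp_induct)
    (auto intro: rtranclp.rtrancl_into_rtrancl derives1_context)

lemma derives1_production: "(A, \<alpha>) \<in> P \<Longrightarrow> derives1 P (Nt A # v) (\<alpha> @ v)"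
  unfolding derives1_def by (metis append_Cons append_Nil)

text \<open>Serves to replace the nonterminals of a finite grammar by natural numbers, as
  \<open>CFL\<close> prescribes.\<close>

definition rename_prods :: "('m \<Rightarrow> 'n) \<Rightarrow> ('m, 't) prods \<Rightarrow> ('n, 't) prods" where
  "rename_prods f P = (\<lambda>(A, \<alpha>). (f A, map (map_sym f id) \<alpha>)) ` P"

lemma derives1_rename:
  assumes "derives1 P u v"
  shows "derives1 (rename_prods f P) (map (map_sym f id) u) (map (map_sym f id) v)"
proof -
  obtain l A r \<alpha> where "(A, \<alpha>) \<in> P" "u = l @ [Nt A] @ r" "v = l @ \<alpha> @ r"
    using assms unfolding derives1_def by blast
  moreover from this have "(f A, map (map_sym f id) \<alpha>) \<in> rename_prods f P"
    unfolding rename_prods_def by force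
  ultimately show ?thesis unfolding derives1_def by fastforce
qed

lemma derives_rename:
  "(derives1 P)\<^sup>*\<^sup>* u v \<Longrightarrow>
   (derives1 (rename_prods f P))\<^sup>*\<^sup>* (map (map_sym f id) u) (map (map_sym f id) v)"
proof (induction rule: rtranclp_induct)
  case base
  show ?case by (rule rtranclp.rtrancl_refl)
next
  case (step y z)
  show ?case by (rule rtranclp.rtrancl_into_rtrancl[OF step.IH derives1_rename[OF step.hyps(2)]])
qed

text \<open>Renaming maps derivations to derivations and fixes terminals. This holds for every
  \<open>f\<close>, since merging nonterminals can only add derivations.\<close>

lemma gen_lang_rename_subset: "gen_lang P S \<subseteq> gen_lang (rename_prods f P) (f S)"
proof
  fix w assume "w \<in> gen_lang P S"
  then have "(derives1 P)\<^sup>*\<^sup>* [Nt S] (map Tm w)" unfolding gen_lang_def by simp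
  from derives_rename[OF this, of f] have
    "(derives1 (rename_prods f P))\<^sup>*\<^sup>* [Nt (f S)] (map (map_sym f id) (map Tm w))" by simp
  moreover have "map (map_sym f id) (map Tm w) = map Tm w" by (induction w) auto
  ultimately show "w \<in> gen_lang (rename_prods f P) (f S)"
    unfolding gen_lang_def by (simp del: map_map)
qed

text \<open>Symbols that occur only on right-hand sides count as well, so that a left inverse on
  this set undoes a renaming on whole productions.\<close>

definition nonterminals :: "('n, 't) prods \<Rightarrow> 'n set" where
  "nonterminals P = (\<Union>(A, \<alpha>)\<in>P. insert A (\<Union>X\<in>set \<alpha>. set1_sym X))"

lemma finite_nonterminals: "finite P \<Longrightarrow> finite (nonterminals P)"
proof -
  have "finite (set1_sym X)" for X :: "('n, 't) sym" by (cases X) auto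
  then show "finite P \<Longrightarrow> finite (nonterminals P)" unfolding nonterminals_def by auto
qed

lemma rename_prods_id:
  assumes "\<And>A. A \<in> nonterminals P \<Longrightarrow> g (f A) = A"
  shows "rename_prods g (rename_prods f P) = P"
proof -
  have sym: "map_sym g id (map_sym f id X) = X" if "\<And>A. A \<in> set1_sym X \<Longrightarrow> g (f A) = A"
    for X :: "('a, 'b) sym"
    using that by (cases X) auto
  have "(g (f A), map (map_sym g id) (map (map_sym f id) \<alpha>)) = (A, \<alpha>)" if "(A, \<alpha>) \<in> P" for A \<alpha>
  proof -
    have "A \<in> nonterminals P" "\<And>X. X \<in> set \<alpha> \<Longrightarrow> set1_sym X \<subseteq> nonterminals P"
      using that unfolding nonterminals_def by blast+
    then have "map (map_sym g id \<circ> map_sym f id) \<alpha> = \<alpha>"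
      using assms by (intro map_idI) (auto intro!: sym)
    then show ?thesis using assms \<open>A \<in> nonterminals P\<close> by simp
  qed
  then show ?thesis unfolding rename_prods_def image_image by (force simp: case_prod_beta)
qed

text \<open>One inclusion is \<open>gen_lang_rename_subset\<close> for \<open>f\<close>, the other
  is the same lemma for a left inverse of \<open>f\<close>, which restores the original grammar. The
  start symbol is inserted because it may occur in no production.\<close>

lemma gen_lang_rename:
  assumes "inj_on f (insert S (nonterminals P))"
  shows "gen_lang (rename_prods f P) (f S) = gen_lang P S"
proof
  define g where "g = inv_into (insert S (nonterminals P)) f"
  have "g (f A) = A" if "A \<in> insert S (nonterminals P)" for A
    unfolding g_def using inv_into_f_f[OF assms that] .
  then have "rename_prods g (rename_prods f P) = P" "g (f S) = S"
    using rename_prods_id[of P g f] by simp_all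
  then show "gen_lang (rename_prods f P) (f S) \<subseteq> gen_lang P S"
    using gen_lang_rename_subset[of "rename_prods f P" "f S" g] by simp
qed (rule gen_lang_rename_subset)

lemma gen_lang_in_CFL:
  fixes P :: "('n, 'a) prods"
  assumes "finite P" and terms: "\<And>A \<alpha> a. (A, \<alpha>) \<in> P \<Longrightarrow> Tm a \<in> set \<alpha> \<Longrightarrow> a \<in> \<Sigma>"
  shows "gen_lang P S \<in> CFL \<Sigma>"
proof -
  have "finite (insert S (nonterminals P))" using assms(1) by (simp add: finite_nonterminals)
  then obtain f :: "'n \<Rightarrow> nat" where inj: "inj_on f (insert S (nonterminals P))"
    using finite_imp_inj_to_nat_seg by blast
  have in_rename: "Tm a \<in> set (map (map_sym f id) \<alpha>) \<Longrightarrow> Tm a \<in> set \<alpha>" for a and \<alpha> :: "('n, 'a) sym list"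
  proof -
    have "map_sym f id X = Tm a \<Longrightarrow> X = Tm a" for X :: "('n, 'a) sym" by (cases X) auto
    then show "Tm a \<in> set (map (map_sym f id) \<alpha>) \<Longrightarrow> Tm a \<in> set \<alpha>" by force
  qed
  have "a \<in> \<Sigma>" if "(B, \<beta>) \<in> rename_prods f P" "Tm a \<in> set \<beta>" for B \<beta> a
  proof -
    obtain A \<alpha> where "(A, \<alpha>) \<in> P" "\<beta> = map (map_sym f id) \<alpha>"
      using \<open>(B, \<beta>) \<in> rename_prods f P\<close> unfolding rename_prods_def by auto
    then show ?thesis using \<open>Tm a \<in> set \<beta>\<close> terms in_rename by blast
  qed
  then have "\<forall>(A, \<alpha>) \<in> rename_prods f P. \<forall>a. Tm a \<in> set \<alpha> \<longrightarrow> a \<in> \<Sigma>" by blast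
  moreover have "finite (rename_prods f P)" unfolding rename_prods_def using assms(1) by simp
  ultimately have "gen_lang (rename_prods f P) (f S) \<in> CFL \<Sigma>" unfolding CFL_def by blast
  then show ?thesis using gen_lang_rename[OF inj] by simp
qed

section \<open>Language semantics of sentential forms\<close>

definition conc :: "'t list set \<Rightarrow> 't list set \<Rightarrow> 't list set" where
  "conc X Y = (\<Union>x\<in>X. \<Union>y\<in>Y. {x @ y})"

lemma conc_assoc: "conc (conc X Y) Z = conc X (conc Y Z)"
  by (simp add: conc_def)

lemma Cons_image_conc: "(#) a ` conc X Y = conc ((#) a ` X) Y"
  by (simp add: conc_def image_UN)

lemma conc_Nil [simp]: "conc {[]} X = X"
  by (simp add: conc_def)

text \<open>Interpreting each nonterminal \<open>A\<close> as the language \<open>L A\<close> turns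
  a grammar into a system of inclusions between languages.\<close>

fun sem :: "('n \<Rightarrow> 't list set) \<Rightarrow> ('n, 't) sym list \<Rightarrow> 't list set" where
  "sem L [] = {[]}"
| "sem L (Tm a # u) = (#) a ` sem L u"
| "sem L (Nt A # u) = conc (L A) (sem L u)"

lemma sem_append: "sem L (u @ v) = conc (sem L u) (sem L v)"
  by (induction u rule: sem.induct[of _ L]) (simp_all add: conc_assoc Cons_image_conc)

lemma sem_terminals: "sem L (map Tm w) = {w}"
  by (induction w) auto

text \<open>When \<open>L\<close> satisfies the inclusions of the grammar, a derivation step can
  only shrink \<open>sem L\<close>. A derived word \<open>w\<close> denotes \<open>{w}\<close>, so
  it lies in \<open>L S\<close>.\<close>

lemma gen_lang_subset_presolution:
  assumes "\<And>A \<alpha>. (A, \<alpha>) \<in> P \<Longrightarrow> sem L \<alpha> \<subseteq> L A"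
  shows "gen_lang P S \<subseteq> L S"
proof
  have step: "sem L v \<subseteq> sem L u" if "derives1 P u v" for u v
  proof -
    from that obtain l A r \<alpha> where "(A, \<alpha>) \<in> P" "u = l @ [Nt A] @ r" "v = l @ \<alpha> @ r"
      unfolding derives1_def by blast
    with assms[of A \<alpha>] show ?thesis by (auto simp: sem_append conc_def)
  qed
  have "sem L v \<subseteq> sem L u" if "(derives1 P)\<^sup>*\<^sup>* u v" for u v
    using that by (induction rule: rtranclp_induct) (use step in blast)+
  then have "(derives1 P)\<^sup>*\<^sup>* [Nt S] (map Tm w) \<Longrightarrow> w \<in> sem L [Nt S]" for w
    using sem_terminals by fastforce
  then show "w \<in> L S" if "w \<in> gen_lang P S" for w
    using that unfolding gen_lang_def by (auto simp: conc_def)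
qed


section \<open>From pushdown generators to grammars\<close>

text \<open>
  A tuple \<open>(p, Z, q, \<gamma>, v)\<close> in \<open>D\<close> is a move from \<open>p\<close> to \<open>q\<close> which replaces \<open>Z\<close> by \<open>\<gamma>\<close> and emits
  \<open>v\<close>.
\<close>
inductive empties :: "('q \<times> 's \<times> 'q \<times> 's list \<times> 't list) set \<Rightarrow>
    'q \<Rightarrow> 's list \<Rightarrow> 'q \<Rightarrow> 't list \<Rightarrow> bool" for D where
  Nil: "empties D p [] p []"
| Move: "(p, Z, q, \<gamma>, v) \<in> D \<Longrightarrow> empties D q (\<gamma> @ s) r w \<Longrightarrow> empties D p (Z # s) r (v @ w)"

text \<open>A move depends only on the top of the stack, so a run that removes \<open>s\<close>
  works unchanged above \<open>s'\<close>.\<close>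

lemma empties_append:
  "empties D p s q v \<Longrightarrow> empties D q s' r w \<Longrightarrow> empties D p (s @ s') r (v @ w)"
  by (induction rule: empties.induct) (auto intro: empties.Move)

section \<open>The triple construction and its correctness\<close>

text \<open>
  In the triple construction, the nonterminal \<open>Some (p, Z, r)\<close> stands for the outputs of the runs
  from \<open>p\<close> to \<open>r\<close> whose net effect is to pop \<open>Z\<close>; the nonterminal \<open>None\<close> is the start symbol.
\<close>
fun chains :: "'q set \<Rightarrow> 'q \<Rightarrow> 's list \<Rightarrow> 'q \<Rightarrow> (('q \<times> 's \<times> 'q) option, 't) sym list set" where
  "chains Q p [] r = (if p = r then {[]} else {})"
| "chains Q p (Z # s) r = (\<Union>q\<in>Q. (#) (Nt (Some (p, Z, q))) ` chains Q q s r)"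

lemma finite_chains: "finite Q \<Longrightarrow> finite (chains Q p s r)"
  by (induction s arbitrary: p) auto

lemma chains_no_terminals: "\<beta> \<in> chains Q p s r \<Longrightarrow> Tm a \<notin> set \<beta>"
  by (induction s arbitrary: p \<beta>) (auto split: if_splits)

text \<open>The split state is the one reached after popping \<open>s\<close>. For empty
  \<open>s\<close> it is \<open>p\<close> itself, which is where \<open>p \<in> Q\<close>
  enters.\<close>

lemma chains_append:
  assumes "\<beta> \<in> chains Q p (s @ s') r" "p \<in> Q"
  shows "\<exists>q\<in>Q. \<exists>\<beta>\<^sub>1\<in>chains Q p s q. \<exists>\<beta>\<^sub>2\<in>chains Q q s' r. \<beta> = \<beta>\<^sub>1 @ \<beta>\<^sub>2"
  using assms
proof (induction s arbitrary: p \<beta>)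
  case Nil
  then show ?case by auto
next
  case (Cons Z s)
  then obtain p' \<beta>' where *: "p' \<in> Q" "\<beta> = Nt (Some (p, Z, p')) # \<beta>'" "\<beta>' \<in> chains Q p' (s @ s') r"
    by auto
  then obtain q \<beta>\<^sub>1 \<beta>\<^sub>2 where "q \<in> Q" "\<beta>\<^sub>1 \<in> chains Q p' s q" "\<beta>\<^sub>2 \<in> chains Q q s' r" "\<beta>' = \<beta>\<^sub>1 @ \<beta>\<^sub>2"
    using Cons.IH by blast
  with * show ?case
    by (intro bexI[of _ q] bexI[of _ "Nt (Some (p, Z, p')) # \<beta>\<^sub>1"] bexI[of _ \<beta>\<^sub>2]) auto
qed

text \<open>In \<open>move\<close>, the chain \<beta> guesses the states in which the successive
  symbols of \<gamma> have been popped.\<close>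

inductive_set triple_prods :: "('q \<times> 's \<times> 'q \<times> 's list \<times> 't list) set \<Rightarrow> 'q set \<Rightarrow> 'q \<Rightarrow> 's \<Rightarrow>
    'q set \<Rightarrow> (('q \<times> 's \<times> 'q) option, 't) prods" for D Q p\<^sub>0 Z\<^sub>0 F where
  start: "r \<in> F \<Longrightarrow> (None, [Nt (Some (p\<^sub>0, Z\<^sub>0, r))]) \<in> triple_prods D Q p\<^sub>0 Z\<^sub>0 F"
| move: "(p, Z, q, \<gamma>, v) \<in> D \<Longrightarrow> r \<in> Q \<Longrightarrow> \<beta> \<in> chains Q q \<gamma> r \<Longrightarrow>
    (Some (p, Z, r), map Tm v @ \<beta>) \<in> triple_prods D Q p\<^sub>0 Z\<^sub>0 F"

lemma finite_triple_prods:
  assumes "finite D" "finite Q" "finite F"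
  shows "finite (triple_prods D Q p\<^sub>0 Z\<^sub>0 F)"
proof -
  let ?S = "(\<lambda>r. (None, [Nt (Some (p\<^sub>0, Z\<^sub>0, r))])) ` F \<union>
    (\<Union>((p, Z, q, \<gamma>, v), r)\<in>D \<times> Q. (\<lambda>\<beta>. (Some (p, Z, r), map Tm v @ \<beta>)) ` chains Q q \<gamma> r)"
  have "triple_prods D Q p\<^sub>0 Z\<^sub>0 F \<subseteq> ?S"
  proof (rule subrelI)
    fix A \<alpha> assume "(A, \<alpha>) \<in> triple_prods D Q p\<^sub>0 Z\<^sub>0 F"
    then show "(A, \<alpha>) \<in> ?S"
    proof cases
      case (start r)
      then show ?thesis by simp
    next
      case (move p Z q \<gamma> v r \<beta>)
      then show ?thesis by (intro UnI2 UN_I[of "((p, Z, q, \<gamma>, v), r)"]) simp_all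
    qed
  qed
  moreover have "finite ?S"
    using assms by (auto intro!: finite_chains simp: case_prod_beta)
  ultimately show ?thesis by (rule finite_subset)
qed

lemma sem_chains:
  assumes "\<And>p Z r. L (Some (p, Z, r)) = {w. empties D p [Z] r w}"
  shows "\<beta> \<in> chains Q p s r \<Longrightarrow> w \<in> sem L \<beta> \<Longrightarrow> empties D p s r w"
proof (induction s arbitrary: p \<beta> w)
  case Nil
  then show ?case by (auto split: if_splits intro: empties.Nil)
next
  case (Cons Z s)
  then obtain q \<beta>' x y where "\<beta>' \<in> chains Q q s r" "y \<in> sem L \<beta>'" "empties D p [Z] q x" "w = x @ y"
    using assms by (auto simp: conc_def)
  then show ?case using Cons.IH empties_append[of D p "[Z]" q x s r y] by simp
qed

text \<open>The languages of actual runs satisfy the inclusions of the grammar, hence they bound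
  what it generates.\<close>

lemma triple_prods_sound:
  "gen_lang (triple_prods D Q p\<^sub>0 Z\<^sub>0 F) None \<subseteq> {w. \<exists>r\<in>F. empties D p\<^sub>0 [Z\<^sub>0] r w}"
proof -
  define L where "L A = (case A of None \<Rightarrow> {w. \<exists>r\<in>F. empties D p\<^sub>0 [Z\<^sub>0] r w}
    | Some (p, Z, r) \<Rightarrow> {w. empties D p [Z] r w})" for A
  have L: "L (Some (p, Z, r)) = {w. empties D p [Z] r w}" for p Z r
    unfolding L_def by simp
  have "sem L \<alpha> \<subseteq> L A" if "(A, \<alpha>) \<in> triple_prods D Q p\<^sub>0 Z\<^sub>0 F" for A \<alpha>
    using that
  proof cases
    case (start r)
    then show ?thesis by (auto simp: L_def conc_def)
  next
    case (move p Z q \<gamma> v r \<beta>)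
    have "empties D p [Z] r (v @ w)" if "w \<in> sem L \<beta>" for w
      using sem_chains[OF L move(5) that] move(3) empties.Move[of p Z q \<gamma> v D "[]"] by simp
    then show ?thesis using move by (auto simp: L sem_append sem_terminals conc_def)
  qed
  from gen_lang_subset_presolution[OF this, where S = None] show ?thesis by (simp add: L_def)
qed

text \<open>The induction follows the run, whose first move turns \<open>Z # s\<close> into
  \<open>\<gamma> @ s\<close>; therefore the claim speaks of whole stacks and chains.\<close>

lemma triple_prods_complete:
  assumes closed: "\<And>p Z q \<gamma> v. (p, Z, q, \<gamma>, v) \<in> D \<Longrightarrow> q \<in> Q"
  shows "empties D p s r w \<Longrightarrow>
    \<exists>\<beta>\<in>chains Q p s r. (derives1 (triple_prods D Q p\<^sub>0 Z\<^sub>0 F))\<^sup>*\<^sup>* \<beta> (map Tm w)"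
proof (induction rule: empties.induct)
  case (Nil p)
  then show ?case by simp
next
  case (Move p Z q \<gamma> v s r w)
  let ?P = "triple_prods D Q p\<^sub>0 Z\<^sub>0 F"
  obtain \<beta> where "\<beta> \<in> chains Q q (\<gamma> @ s) r" and \<beta>: "(derives1 ?P)\<^sup>*\<^sup>* \<beta> (map Tm w)"
    using Move.IH by blast
  \<comment> \<open>The chain is cut at the state \<open>q'\<close> where \<gamma> is used up: the
    first piece enters a production for \<open>Z\<close>, the second continues the chain of
    \<open>s\<close>.\<close>
  then obtain q' \<beta>\<^sub>1 \<beta>\<^sub>2 where *: "q' \<in> Q" "\<beta>\<^sub>1 \<in> chains Q q \<gamma> q'" "\<beta>\<^sub>2 \<in> chains Q q' s r" "\<beta> = \<beta>\<^sub>1 @ \<beta>\<^sub>2"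
    using chains_append closed[OF Move.hyps(1)] by meson
  have "derives1 ?P (Nt (Some (p, Z, q')) # \<beta>\<^sub>2) ((map Tm v @ \<beta>\<^sub>1) @ \<beta>\<^sub>2)"
    using * Move.hyps(1) by (intro derives1_production triple_prods.move)
  moreover have "(derives1 ?P)\<^sup>*\<^sup>* (map Tm v @ \<beta> @ []) (map Tm v @ map Tm w @ [])"
    using derives_context[OF \<beta>] .
  ultimately have "(derives1 ?P)\<^sup>*\<^sup>* (Nt (Some (p, Z, q')) # \<beta>\<^sub>2) (map Tm (v @ w))"
    using * by (auto intro: converse_rtranclp_into_rtranclp)
  moreover have "Nt (Some (p, Z, q')) # \<beta>\<^sub>2 \<in> chains Q p (Z # s) r" using * by auto
  ultimately show ?case by blast
qed

lemma gen_lang_triple_prods: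
  assumes closed: "\<And>p Z q \<gamma> v. (p, Z, q, \<gamma>, v) \<in> D \<Longrightarrow> q \<in> Q"
  shows "gen_lang (triple_prods D Q p\<^sub>0 Z\<^sub>0 F) None = {w. \<exists>r\<in>F. empties D p\<^sub>0 [Z\<^sub>0] r w}"
    (is "gen_lang ?P None = _")
proof (intro equalityI triple_prods_sound subsetI)
  fix w assume "w \<in> {w. \<exists>r\<in>F. empties D p\<^sub>0 [Z\<^sub>0] r w}"
  then obtain r where r: "r \<in> F" "empties D p\<^sub>0 [Z\<^sub>0] r w" by blast
  have "\<exists>\<beta>\<in>chains Q p\<^sub>0 [Z\<^sub>0] r. (derives1 ?P)\<^sup>*\<^sup>* \<beta> (map Tm w)"
    by (rule triple_prods_complete[OF _ r(2)]) (rule closed)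
  then obtain \<beta> where "\<beta> \<in> chains Q p\<^sub>0 [Z\<^sub>0] r" "(derives1 ?P)\<^sup>*\<^sup>* \<beta> (map Tm w)" by blast
  moreover from this(1) have "\<beta> = [Nt (Some (p\<^sub>0, Z\<^sub>0, r))]" by (auto split: if_splits)
  moreover have "derives1 ?P [Nt None] ([Nt (Some (p\<^sub>0, Z\<^sub>0, r))] @ [])"
    by (intro derives1_production triple_prods.start r)
  ultimately show "w \<in> gen_lang ?P None"
    unfolding gen_lang_def by (auto intro: converse_rtranclp_into_rtranclp)
qed

text \<open>Chains contain only nonterminals, so every terminal of the triple grammar stems from a
  word emitted by a move.\<close>

lemma empties_CFL:
  assumes "finite D" "finite Q" "finite F"
    and closed: "\<And>p Z q \<gamma> v. (p, Z, q, \<gamma>, v) \<in> D \<Longrightarrow> q \<in> Q"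
    and terms: "\<And>p Z q \<gamma> v. (p, Z, q, \<gamma>, v) \<in> D \<Longrightarrow> set v \<subseteq> \<Sigma>"
  shows "{w. \<exists>r\<in>F. empties D p\<^sub>0 [Z\<^sub>0] r w} \<in> CFL \<Sigma>"
proof -
  have "finite (triple_prods D Q p\<^sub>0 Z\<^sub>0 F)"
    using assms(1-3) by (rule finite_triple_prods)
  then have "gen_lang (triple_prods D Q p\<^sub>0 Z\<^sub>0 F) None \<in> CFL \<Sigma>"
  proof (rule gen_lang_in_CFL)
    fix A \<alpha> a assume "(A, \<alpha>) \<in> triple_prods D Q p\<^sub>0 Z\<^sub>0 F" "Tm a \<in> set \<alpha>"
    then show "a \<in> \<Sigma>"
    proof cases
      case (start r)
      then show ?thesis using \<open>Tm a \<in> set \<alpha>\<close> by simp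
    next
      case (move p Z q \<gamma> v r \<beta>)
      then show ?thesis using \<open>Tm a \<in> set \<alpha>\<close> terms[OF move(3)] chains_no_terminals[OF move(5), of a]
        by auto
    qed
  qed
  moreover have "gen_lang (triple_prods D Q p\<^sub>0 Z\<^sub>0 F) None = {w. \<exists>r\<in>F. empties D p\<^sub>0 [Z\<^sub>0] r w}"
    by (rule gen_lang_triple_prods) (rule closed)
  ultimately show ?thesis by simp
qed


section \<open>Ranges of pushdown transducers\<close>

definition cells :: "'a set \<Rightarrow> 'a cell set" where
  "cells \<Sigma> = insert LeftEnd (insert RightEnd (Inp ` \<Sigma>))"

text \<open>
  The state records the cell under the head, and a head move guesses the next cell.  Accepting
  states, which have no moves of their own, silently empty the stack.
\<close>
inductive_set guess_moves :: "'a set \<Rightarrow> ('q, 's, 'a, 'b) npda \<Rightarrow>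
    (('q \<times> 'a cell) \<times> 's \<times> ('q \<times> 'a cell) \<times> 's list \<times> 'b list) set" for \<Sigma> M where
  simulate: "((q, c, Z), (q', \<gamma>, mv, b)) \<in> trans M \<Longrightarrow>
    c' \<in> (if mv then insert RightEnd (Inp ` \<Sigma>) else {c}) \<Longrightarrow>
    ((q, c), Z, (q', c'), \<gamma>, case b of None \<Rightarrow> [] | Some y \<Rightarrow> [y]) \<in> guess_moves \<Sigma> M"
| drain: "q \<in> acc M \<Longrightarrow> c \<in> cells \<Sigma> \<Longrightarrow> Z \<in> stack_syms M \<Longrightarrow>
    ((q, c), Z, (q, c), [], []) \<in> guess_moves \<Sigma> M"

lemma wf_npda_trans:
  assumes "wf_npda \<Sigma> \<Gamma> M" "((q, c, Z), (q', \<gamma>, mv, b)) \<in> trans M"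
  shows "q \<in> states M" "q \<notin> acc M" "c \<in> cells \<Sigma>" "q' \<in> states M" "set \<gamma> \<subseteq> stack_syms M"
    "set_option b \<subseteq> \<Gamma>" "c = RightEnd \<Longrightarrow> \<not> mv"
proof -
  have *: "\<forall>((q, c, Z), (q', \<gamma>, mv, b)) \<in> trans M.
        q \<in> states M - acc M \<and> set_cell c \<subseteq> \<Sigma> \<and> Z \<in> stack_syms M \<and>
        q' \<in> states M \<and> set \<gamma> \<subseteq> stack_syms M \<and> set_option b \<subseteq> \<Gamma> \<and>
        (c = RightEnd \<longrightarrow> \<not> mv)"
    using assms(1) unfolding wf_npda_def by (elim conjE)
  have "set_cell c \<subseteq> \<Sigma>" using bspec[OF * assms(2)] by simp
  then show "c \<in> cells \<Sigma>" by (cases c) (simp_all add: cells_def)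
  show "q \<in> states M" "q \<notin> acc M" "q' \<in> states M"
    "set \<gamma> \<subseteq> stack_syms M" "set_option b \<subseteq> \<Gamma>" "c = RightEnd \<Longrightarrow> \<not> mv"
    using bspec[OF * assms(2)] by simp_all
qed

lemma finite_guess_moves:
  assumes wf: "wf_npda \<Sigma> \<Gamma> M" and "finite \<Sigma>"
  shows "finite (guess_moves \<Sigma> M)"
proof -
  let ?S = "(\<lambda>(((q, c, Z), (q', \<gamma>, mv, b)), c').
      ((q, c), Z, (q', c'), \<gamma>, case b of None \<Rightarrow> [] | Some y \<Rightarrow> [y])) ` (trans M \<times> cells \<Sigma>) \<union>
    (\<lambda>(q, c, Z). ((q, c), Z, (q, c), [], [])) ` (acc M \<times> cells \<Sigma> \<times> stack_syms M)"
  have "guess_moves \<Sigma> M \<subseteq> ?S"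
  proof (rule subsetI)
    fix x assume "x \<in> guess_moves \<Sigma> M"
    moreover obtain q c Z q' c' \<gamma> v where x: "x = ((q, c), Z, (q', c'), \<gamma>, v)"
      by (metis surj_pair)
    ultimately have "((q, c), Z, (q', c'), \<gamma>, v) \<in> guess_moves \<Sigma> M" by simp
    then show "x \<in> ?S"
    proof cases
      case (simulate mv b)
      then have "c' \<in> cells \<Sigma>"
        using wf_npda_trans(3)[OF wf] by (auto simp: cells_def split: if_splits)
      with simulate x show ?thesis
        by (intro UnI1 image_eqI[of _ _ "(((q, c, Z), (q', \<gamma>, mv, b)), c')"]) simp_all
    next
      case drain
      with x show ?thesis by (intro UnI2 image_eqI[of _ _ "(q, c, Z)"]) simp_all
    qed
  qed
  moreover have "finite (trans M)" "finite (acc M)" "finite (stack_syms M)"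
    using wf unfolding wf_npda_def by (auto intro: finite_subset)
  then have "finite ?S" using \<open>finite \<Sigma>\<close> by (simp add: cells_def)
  ultimately show ?thesis by (rule finite_subset)
qed

section \<open>Simulation of computations by guessing runs and conversely\<close>

text \<open>These are the nonempty suffixes of end-marked tapes over \<Sigma>, which is what the
  head can have in front of it.\<close>

fun tape_rest :: "'a set \<Rightarrow> 'a cell list \<Rightarrow> bool" where
  "tape_rest \<Sigma> [] \<longleftrightarrow> False"
| "tape_rest \<Sigma> (c # t) \<longleftrightarrow>
     (if c = RightEnd then t = []
      else c \<in> cells \<Sigma> \<and> (\<exists>x. set x \<subseteq> \<Sigma> \<and> t = map Inp x @ [RightEnd]))"

text \<open>Shows that the cell revealed by a head move is among those that
  \<open>guess_moves\<close> may guess.\<close>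

lemma tape_rest_move:
  assumes "tape_rest \<Sigma> (c # t)" "c \<noteq> RightEnd"
  obtains c' t' where "t = c' # t'" "c' \<in> insert RightEnd (Inp ` \<Sigma>)" "tape_rest \<Sigma> t"
proof -
  obtain x where x: "set x \<subseteq> \<Sigma>" "t = map Inp x @ [RightEnd]" using assms by auto
  show thesis
  proof (cases x)
    case Nil
    then show thesis using that x by auto
  next
    case (Cons a y)
    then have "tape_rest \<Sigma> t" using x by (auto simp: cells_def)
    then show thesis using that x Cons by auto
  qed
qed

text \<open>Lets a tape be rebuilt from right to left out of guessed cells.\<close>

lemma tape_rest_Cons:
  assumes "tape_rest \<Sigma> (c' # t)" "c' \<in> insert RightEnd (Inp ` \<Sigma>)" "c \<in> cells \<Sigma>" "c \<noteq> RightEnd"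
  shows "tape_rest \<Sigma> (c # c' # t)"
proof (cases "c' = RightEnd")
  case True
  then have "c' # t = map Inp [] @ [RightEnd]" using assms by simp
  then show ?thesis using assms(3,4) by (metis empty_set empty_subsetI tape_rest.simps(2))
next
  case False
  then obtain a x where "a \<in> \<Sigma>" "set x \<subseteq> \<Sigma>" "c' # t = map Inp (a # x) @ [RightEnd]"
    using assms by auto
  then have "set (a # x) \<subseteq> \<Sigma> \<and> c' # t = map Inp (a # x) @ [RightEnd]" by simp
  then show ?thesis using assms(3,4) by (metis tape_rest.simps(2))
qed

text \<open>Bridges two modes of acceptance: \<open>outputs\<close> ignores the remaining stack,
  whereas \<open>empties\<close> must remove it.\<close>

lemma empties_acc:
  assumes "q \<in> acc M" "c \<in> cells \<Sigma>" "set s \<subseteq> stack_syms M"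
  shows "empties (guess_moves \<Sigma> M) (q, c) s (q, c) []"
  using assms(3)
proof (induction s)
  case Nil
  then show ?case by (rule_tac empties.Nil)
next
  case (Cons Z s)
  then show ?case
    using empties.Move[of "(q, c)" Z "(q, c)" "[]" "[]" "guess_moves \<Sigma> M" s "(q, c)" "[]"]
      guess_moves.drain[OF assms(1,2)] by simp
qed

text \<open>Accepting states have no transitions, so only draining moves apply; they keep the state
  and emit nothing.\<close>

lemma empties_acc_output:
  assumes "wf_npda \<Sigma> \<Gamma> M" "empties (guess_moves \<Sigma> M) qc s r w" "fst qc \<in> acc M"
  shows "w = []"
  using assms(2,3)
proof (induction rule: empties.induct)
  case (Nil p)
  then show ?case by simp
next
  case (Move p Z q \<gamma> v s r w)
  obtain p1 p2 q1 q2 where "p = (p1, p2)" "q = (q1, q2)" by fastforce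
  with Move.hyps(1) have "((p1, p2), Z, (q1, q2), \<gamma>, v) \<in> guess_moves \<Sigma> M" by simp
  then show ?case
  proof cases
    case (simulate mv b)
    then show ?thesis using wf_npda_trans(2)[OF assms(1)] Move.prems \<open>p = (p1, p2)\<close> by auto
  next
    case drain
    then show ?thesis using Move.IH Move.prems \<open>p = (p1, p2)\<close> \<open>q = (q1, q2)\<close> by simp
  qed
qed

text \<open>Each step is matched by a move that guesses the cell actually found under the head, and
  draining completes the run after acceptance.\<close>

lemma steps_imp_empties:
  assumes wf: "wf_npda \<Sigma> \<Gamma> M"
    and "(step M)\<^sup>*\<^sup>* C C'" "C = (q, t, s, w)" "C' = (q', t', s', w')" "q' \<in> acc M"
    and "tape_rest \<Sigma> t" "set s \<subseteq> stack_syms M"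
  shows "\<exists>c\<in>cells \<Sigma>. \<exists>v. w' = w @ v \<and> empties (guess_moves \<Sigma> M) (q, hd t) s (q', c) v"
  using assms(2-)
proof (induction arbitrary: q t s w rule: converse_rtranclp_induct)
  case base
  then obtain c u where "t = c # u" by (cases t) auto
  with base have "c \<in> cells \<Sigma>" by (auto simp: cells_def split: if_splits)
  with base \<open>t = c # u\<close> show ?case using empties_acc[of q M c \<Sigma> s] by auto
next
  case (step y z)
  from step.hyps(1)[unfolded step.prems(1)] obtain c u Z s1 q1 \<gamma> mv b where
    tr: "((q, c, Z), (q1, \<gamma>, mv, b)) \<in> trans M" and
    eq: "t = c # u" "s = Z # s1"
    "z = (q1, if mv then u else t, \<gamma> @ s1, w @ (case b of None \<Rightarrow> [] | Some y \<Rightarrow> [y]))"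
    by (cases rule: step.cases) auto
  define t1 where "t1 = (if mv then u else t)"
  define v1 where "v1 = (case b of None \<Rightarrow> [] | Some y \<Rightarrow> [y])"
  have t1: "tape_rest \<Sigma> t1 \<and> hd t1 \<in> (if mv then insert RightEnd (Inp ` \<Sigma>) else {c})"
  proof (cases mv)
    case True
    \<comment> \<open>No transition moves off the right endmarker, so a next cell exists.\<close>
    then have "c \<noteq> RightEnd" using wf_npda_trans(7)[OF wf tr] by blast
    then show ?thesis using step.prems True tape_rest_move[of \<Sigma> c u]
      unfolding t1_def eq by (metis list.sel(1))
  next
    case False
    then show ?thesis using step.prems unfolding t1_def eq by auto
  qed
  have "set (\<gamma> @ s1) \<subseteq> stack_syms M" using step.prems eq wf_npda_trans(5)[OF wf tr] by auto
  then obtain d v where "d \<in> cells \<Sigma>" "w' = (w @ v1) @ v"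
    "empties (guess_moves \<Sigma> M) (q1, hd t1) (\<gamma> @ s1) (q', d) v"
    using step.IH[of q1 t1 "\<gamma> @ s1" "w @ v1"] t1 step.prems eq(3) unfolding t1_def v1_def by blast
  moreover have "((q, c), Z, (q1, hd t1), \<gamma>, v1) \<in> guess_moves \<Sigma> M"
    unfolding v1_def using guess_moves.simulate[OF tr] t1 by blast
  ultimately show ?case using eq(1,2) by (auto intro!: empties.Move)
qed

text \<open>The guesses of a run spell out a tape, which is assembled from the end of the run
  backwards; the prefix \<open>w\<close> stands for output written earlier.\<close>

lemma empties_imp_steps:
  assumes wf: "wf_npda \<Sigma> \<Gamma> M"
    and "empties (guess_moves \<Sigma> M) qc s r v" "fst r \<in> acc M" "qc = (q, c)" "c \<in> cells \<Sigma>"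
  shows "\<exists>t. tape_rest \<Sigma> (c # t) \<and>
    (\<forall>w. \<exists>q' t' s'. (step M)\<^sup>*\<^sup>* (q, c # t, s, w) (q', t', s', w @ v) \<and> q' \<in> acc M)"
  using assms(2-)
proof (induction arbitrary: q c rule: empties.induct)
  case (Nil p)
  \<comment> \<open>Acceptance ignores the unread tape, so the shortest legal completion
    serves.\<close>
  then have *: "tape_rest \<Sigma> (c # (if c = RightEnd then [] else [RightEnd]))" by auto
  show ?case by (rule exI, rule conjI, rule *) (use Nil in auto)
next
  case (Move p Z p' \<gamma> v s r v')
  obtain q1 c1 where p': "p' = (q1, c1)" by fastforce
  from Move.hyps(1)[unfolded p' Move.prems(2)] show ?case
  proof cases
    case (simulate mv b)
    have tr: "((q, c, Z), (q1, \<gamma>, mv, b)) \<in> trans M"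
      and c1: "c1 \<in> (if mv then insert RightEnd (Inp ` \<Sigma>) else {c})"
      and v: "v = (case b of None \<Rightarrow> [] | Some y \<Rightarrow> [y])"
      using simulate by simp_all
    note right_end = wf_npda_trans(7)[OF wf tr]
    have "c1 \<in> cells \<Sigma>" using c1 Move.prems(3) by (auto simp: cells_def split: if_splits)
    then obtain t where t: "tape_rest \<Sigma> (c1 # t)" and
      run: "\<And>w. \<exists>q' t' s'. (step M)\<^sup>*\<^sup>* (q1, c1 # t, \<gamma> @ s, w) (q', t', s', w @ v') \<and> q' \<in> acc M"
      using Move.IH[OF Move.prems(1) p'] by blast
    \<comment> \<open>After a head move the guessed cell \<open>c1\<close> is the right neighbour of
      \<open>c\<close>; otherwise \<open>c1\<close> is \<open>c\<close> and the tape stays as it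
      is.\<close>
    define t1 where "t1 = (if mv then c1 # t else t)"
    have "tape_rest \<Sigma> (c # t1)"
      using c1 t right_end Move.prems(3) tape_rest_Cons[of \<Sigma> c1 t c] unfolding t1_def
      by (cases mv) auto
    moreover have "step M (q, c # t1, Z # s, w) (q1, c1 # t, \<gamma> @ s, w @ v)" for w
      using step.intros[OF tr, of t1 s w] c1 v unfolding t1_def by (cases mv) auto
    then have "\<exists>q' t' s'. (step M)\<^sup>*\<^sup>* (q, c # t1, Z # s, w) (q', t', s', w @ v @ v') \<and> q' \<in> acc M" for w
      using run[of "w @ v"] by (metis append.assoc converse_rtranclp_into_rtranclp)
    ultimately show ?thesis by blast
  next
    \<comment> \<open>Here \<open>q\<close> is already accepting and nothing more is emitted, so the
      empty computation suffices.\<close>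
    case drain
    then have "v' = []" using empties_acc_output[OF wf Move.hyps(2)] p' by simp
    moreover have *: "tape_rest \<Sigma> (c # (if c = RightEnd then [] else [RightEnd]))"
      using Move.prems by auto
    ultimately show ?thesis using drain by (metis append.right_neutral rtranclp.rtrancl_refl)
  qed
qed

text \<open>Accepting computations on arbitrary inputs correspond to guessing runs that start at the
  left endmarker, end in an accepting state and empty the stack.\<close>

lemma outputs_range_CFL:
  fixes M :: "('q, 's, 'a, 'b) npda"
  assumes wf: "wf_npda \<Sigma> \<Gamma> M" and "finite \<Sigma>"
  shows "(\<Union>x\<in>lists \<Sigma>. outputs M x) \<in> CFL \<Gamma>"
proof -
  let ?D = "guess_moves \<Sigma> M" and ?F = "acc M \<times> cells \<Sigma>"
  have fin: "finite (states M)" "finite (stack_syms M)" "finite (trans M)" "finite (acc M)"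
    and bot: "bottom M \<in> stack_syms M" and accs: "acc M \<subseteq> states M"
    using wf unfolding wf_npda_def by (auto intro: finite_subset)
  have cells: "finite (cells \<Sigma>)" using \<open>finite \<Sigma>\<close> by (simp add: cells_def)
  have D: "finite ?D" by (rule finite_guess_moves[OF wf \<open>finite \<Sigma>\<close>])
  have moves: "q \<in> states M \<times> cells \<Sigma> \<and> set v \<subseteq> \<Gamma>" if "(p, Z, q, \<gamma>, v) \<in> ?D" for p Z q \<gamma> v
  proof -
    obtain p1 p2 q1 q2 where pq: "p = (p1, p2)" "q = (q1, q2)" by fastforce
    from that[unfolded pq] show ?thesis
    proof cases
      case (simulate mv b)
      then show ?thesis using wf_npda_trans[OF wf simulate(2)] pq
        by (auto simp: cells_def split: if_splits option.splits)
    next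
      case drain
      then show ?thesis using pq accs by auto
    qed
  qed
  have "{w. \<exists>r\<in>?F. empties ?D (init M, LeftEnd) [bottom M] r w} \<in> CFL \<Gamma>"
    by (rule empties_CFL[of _ "states M \<times> cells \<Sigma>"]) (use moves D fin cells in auto)
  also have "{w. \<exists>r\<in>?F. empties ?D (init M, LeftEnd) [bottom M] r w} = (\<Union>x\<in>lists \<Sigma>. outputs M x)"
  proof (intro equalityI subsetI)
    fix w assume "w \<in> {w. \<exists>r\<in>?F. empties ?D (init M, LeftEnd) [bottom M] r w}"
    then obtain r where r: "fst r \<in> acc M" "empties ?D (init M, LeftEnd) [bottom M] r w" by auto
    have "LeftEnd \<in> cells \<Sigma>" by (simp add: cells_def)
    from empties_imp_steps[OF wf r(2,1) refl this] obtain t where "tape_rest \<Sigma> (LeftEnd # t)" and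
      run: "\<And>w0. \<exists>q' t' s'. (step M)\<^sup>*\<^sup>* (init M, LeftEnd # t, [bottom M], w0) (q', t', s', w0 @ w) \<and> q' \<in> acc M"
      by blast
    \<comment> \<open>A tape suffix beginning with the left endmarker is a complete input tape,
      which yields the argument \<open>x\<close>.\<close>
    then obtain x where "set x \<subseteq> \<Sigma>" "t = map Inp x @ [RightEnd]" by auto
    then have "w \<in> outputs M x" "x \<in> lists \<Sigma>"
      using run[of "[]"] unfolding outputs_def init_config_def by auto
    then show "w \<in> (\<Union>x\<in>lists \<Sigma>. outputs M x)" by blast
  next
    fix w assume "w \<in> (\<Union>x\<in>lists \<Sigma>. outputs M x)"
    then obtain x q t s where x: "x \<in> lists \<Sigma>" "q \<in> acc M"
      "(step M)\<^sup>*\<^sup>* (init M, LeftEnd # map Inp x @ [RightEnd], [bottom M], []) (q, t, s, w)"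
      unfolding outputs_def init_config_def by blast
    then have "tape_rest \<Sigma> (LeftEnd # map Inp x @ [RightEnd])" by (auto simp: cells_def)
    from steps_imp_empties[OF wf x(3) refl refl x(2) this]
    show "w \<in> {w. \<exists>r\<in>?F. empties ?D (init M, LeftEnd) [bottom M] r w}" using bot x(2) by auto
  qed
  finally show ?thesis .
qed


section \<open>The range as a distinguisher\<close>

lemma finite_strings: "finite \<Sigma> \<Longrightarrow> finite (strings \<Sigma> n)"
  unfolding strings_def by (rule finite_lists_length_eq)

lemma card_strings: "finite \<Sigma> \<Longrightarrow> card (strings \<Sigma> n) = card \<Sigma> ^ n"
  unfolding strings_def by (rule card_lists_length_eq)

lemma strings_nonempty: "\<Sigma> \<noteq> {} \<Longrightarrow> strings \<Sigma> n \<noteq> {}"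
proof -
  assume "\<Sigma> \<noteq> {}"
  then obtain a where "a \<in> \<Sigma>" by blast
  then have "replicate n a \<in> strings \<Sigma> n" by (auto simp: strings_def)
  then show ?thesis by blast
qed

lemma not_fools_range:
  assumes "finite \<Sigma>" "2 \<le> card \<Sigma>" and stretch: "stretch_factor \<Sigma> G (\<lambda>n. n + 1)"
  shows "\<not> fools \<Sigma> (\<lambda>n. n + 1) G (G ` lists \<Sigma>)"
proof
  let ?A = "G ` lists \<Sigma>"
  have ne: "strings \<Sigma> n \<noteq> {}" for n using assms(2) by (intro strings_nonempty) auto
  \<comment> \<open>The bound arises as \<open>1 - 1 / card \<Sigma>\<close>, which is smallest for
    two letters.\<close>
  have gap: "1 / 2 \<le> \<bar>measure_pmf.prob (pmf_of_set (strings \<Sigma> n)) {x. G x \<in> ?A}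
      - measure_pmf.prob (pmf_of_set (strings \<Sigma> (n + 1))) {y. y \<in> ?A}\<bar>" for n
  proof -
    have "strings \<Sigma> n \<inter> {x. G x \<in> ?A} = strings \<Sigma> n" by (auto simp: strings_def)
    then have one: "measure_pmf.prob (pmf_of_set (strings \<Sigma> n)) {x. G x \<in> ?A} = 1"
      using ne finite_strings[OF assms(1)] by (simp add: measure_pmf_of_set)
    \<comment> \<open>By the stretch factor, a preimage of a string of length \<open>n + 1\<close>
      has length exactly \<open>n\<close>.\<close>
    have "strings \<Sigma> (n + 1) \<inter> {y. y \<in> ?A} \<subseteq> G ` strings \<Sigma> n"
    proof
      fix y assume y: "y \<in> strings \<Sigma> (n + 1) \<inter> {y. y \<in> ?A}"
      then obtain x where x: "set x \<subseteq> \<Sigma>" "y = G x" by auto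
      moreover have "length x = n" using stretch x y by (simp add: stretch_factor_def strings_def)
      ultimately show "y \<in> G ` strings \<Sigma> n" by (simp add: strings_def)
    qed
    then have "card (strings \<Sigma> (n + 1) \<inter> {y. y \<in> ?A}) \<le> card \<Sigma> ^ n"
      using card_mono card_image_le finite_strings[OF assms(1)] card_strings[OF assms(1)]
      by (metis finite_imageI le_trans)
    then have "real (card (strings \<Sigma> (n + 1) \<inter> {y. y \<in> ?A})) \<le> real (card \<Sigma>) ^ n"
      by (metis of_nat_le_iff of_nat_power)
    then have "measure_pmf.prob (pmf_of_set (strings \<Sigma> (n + 1))) {y. y \<in> ?A}
        \<le> real (card \<Sigma>) ^ n / real (card \<Sigma>) ^ (n + 1)"
      using ne finite_strings[OF assms(1)]
      by (simp add: measure_pmf_of_set card_strings[OF assms(1)] divide_right_mono del: power_Suc)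
    also have "\<dots> = 1 / real (card \<Sigma>)" using assms(2) by simp
    also have "\<dots> \<le> 1 / 2" using assms(2) by (intro divide_left_mono) auto
    finally show ?thesis unfolding one by linarith
  qed
  \<comment> \<open>A constant polynomial refutes negligibility: the value 3 is chosen because 1/3
    is below the gap 1/2.\<close>
  have const_pos: "\<forall>n::nat. 0 < poly [:3 :: int:] (int n)" by simp
  assume "fools \<Sigma> (\<lambda>n. n + 1) G ?A"
  then obtain n0 where "\<bar>measure_pmf.prob (pmf_of_set (strings \<Sigma> n0)) {x. G x \<in> ?A}
      - measure_pmf.prob (pmf_of_set (strings \<Sigma> (n0 + 1))) {y. y \<in> ?A}\<bar>
      \<le> 1 / real_of_int (poly [:3:] (int n0))"
    unfolding fools_def negligible_fn_def using const_pos by blast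
  with gap[of n0] show False by simp
qed

theorem theorem3p12:
  "\<not> (\<exists>(\<Sigma> :: 'a set) G.
        alphabet \<Sigma> \<and> 2 \<le> card \<Sigma> \<and>
        pseudorandom_generator \<Sigma> (\<lambda>n. n + 1) G (CFL \<Sigma>) \<and>
        almost_one_to_one \<Sigma> G \<and>
        (\<lambda>x. {G x}) \<in> CFLMV \<Sigma> \<Sigma>)"
proof (intro notI, elim exE conjE)
  fix \<Sigma> :: "'a set" and G
  assume "alphabet \<Sigma>" and card: "2 \<le> card \<Sigma>"
    and prg: "pseudorandom_generator \<Sigma> (\<lambda>n. n + 1) G (CFL \<Sigma>)"
    and "(\<lambda>x. {G x}) \<in> CFLMV \<Sigma> \<Sigma>"
  then obtain M :: "(nat, nat, 'a, 'a) npda" where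
    "wf_npda \<Sigma> \<Sigma> M" and M: "\<And>x. set x \<subseteq> \<Sigma> \<Longrightarrow> {G x} = outputs M x"
    unfolding CFLMV_def by blast
  moreover have fin: "finite \<Sigma>" using \<open>alphabet \<Sigma>\<close> by (simp add: alphabet_def)
  ultimately have "(\<Union>x\<in>lists \<Sigma>. outputs M x) \<in> CFL \<Sigma>" by (intro outputs_range_CFL)
  also have "(\<Union>x\<in>lists \<Sigma>. outputs M x) = G ` lists \<Sigma>"
    using M by (auto simp: in_lists_conv_set subset_eq)
  finally have "G ` lists \<Sigma> \<in> CFL \<Sigma>" .
  \<comment> \<open>Fooling is demanded only of languages over \<Sigma>, so the range must be seen
    to be one.\<close>
  moreover have "G ` lists \<Sigma> \<subseteq> lists \<Sigma>"
    using prg unfolding pseudorandom_generator_def generator_def by (auto simp: lists_eq_set)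
  ultimately have "fools \<Sigma> (\<lambda>n. n + 1) G (G ` lists \<Sigma>)"
    using prg unfolding pseudorandom_generator_def by blast
  then show False
    using not_fools_range[OF fin card] prg unfolding pseudorandom_generator_def by blast
qed

end
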